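(* Let $\tau:\mathbb{C}_{\langle n\rangle}\to\mathbb{C}$ be a trace (a linear functional with $\tau(PQ)=\tau(QP)$). Then $$\mathrm{Vect}\,\mathbb{C}_{\langle n|\tau\rangle}=\Big\{P\in\mathrm{Vect}\,\mathbb{C}_{\langle n\rangle}\ \Big|\ \sum_{1\le j\le n}\tau(P_j\,(\delta_jR))=0\ \text{ for all }R\in\mathbb{C}_{\langle n\rangle}\Big\}$$ is a Lie subalgebra of $\mathrm{Vect}\,\mathbb{C}_{\langle n\rangle}$.
   Context: $\mathbb{C}_{\langle n\rangle}=\mathbb{C}\langle X_1,\dots,X_n\rangle$ is the ring of noncommutative polynomials and $\mathrm{Vect}\,\mathbb{C}_{\langle n\rangle}=(\mathbb{C}_{\langle n\rangle})^n$. For $P=(P_j)_{1\le j\le n}\in\mathrm{Vect}\,\mathbb{C}_{\langle n\rangle}$, $D_P$ is the derivation of $\mathbb{C}_{\langle n\rangle}$ with $D_PX_j=P_j$. $\mathrm{Vect}\,\mathbb{C}_{\langle n\rangle}$ is a Lie algebra under the bracket $[P,Q]=(D_PQ_j-D_QP_j)_{1\le j\le n}$. The partial cyclic derivatives are the linear maps $\delta_j:\mathbb{C}_{\langle n\rangle}\to\mathbb{C}_{\langle n\rangle}$ with $\delta_j1=0$, $\delta_jX_{i_1}\cdots X_{i_p}=\sum_{k:\,i_k=j}X_{i_{k+1}}\cdots X_{i_p}X_{i_1}\cdots X_{i_{k-1}}$. *)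

theory Defs
  imports
    "HOL-Analysis.Finite_Cartesian_Product"
    "HOL-Library.Poly_Mapping"
begin

section \<open>Lie algebras and Lie subalgebras\<close>

locale lie_algebra = vector_space scale
  for scale :: "'a::field \<Rightarrow> 'b::ab_group_add \<Rightarrow> 'b" +
  fixes bracket :: "'b \<Rightarrow> 'b \<Rightarrow> 'b"
  assumes bracket_add_left: "bracket (x + y) z = bracket x z + bracket y z"
    and bracket_add_right: "bracket x (y + z) = bracket x y + bracket x z"
    and bracket_scale_left: "bracket (scale c x) y = scale c (bracket x y)"
    and bracket_scale_right: "bracket x (scale c y) = scale c (bracket x y)"
    and bracket_self: "bracket x x = 0"
    and jacobi: "bracket x (bracket y z) + bracket y (bracket z x) + bracket z (bracket x y) = 0"
begin

definition lie_subalgebra :: "'b set \<Rightarrow> bool" where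
  "lie_subalgebra S \<longleftrightarrow> subspace S \<and> (\<forall>x\<in>S. \<forall>y\<in>S. bracket x y \<in> S)"

end


section \<open>Noncommutative polynomials\<close>

text \<open>
  The free monoid on \<open>'n\<close>, written additively because the convolution product on
  finitely supported functions takes its exponents in a (not necessarily commutative)
  additive monoid. A list type of its own is used, since \<open>'n list\<close> carries
  no such instance.
\<close>

datatype 'n fword = FWord (letters: "'n list")

instantiation fword :: (type) monoid_add
begin

definition "0 = FWord []"
definition "u + v = FWord (letters u @ letters v)"

instance
  by standard (simp_all add: zero_fword_def plus_fword_def)

end

text \<open>
  The index set of the variables is a finite type \<open>'n\<close> (so \<open>n = CARD('n) \<ge> 1\<close>); the
  ring structure is the convolution algebra of the free monoid, i.e. multiplication
  concatenates words.
\<close>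

type_synonym 'n ncpoly = "'n fword \<Rightarrow>\<^sub>0 complex"

definition nc_scale :: "complex \<Rightarrow> 'n ncpoly \<Rightarrow> 'n ncpoly" where
  "nc_scale c p = Poly_Mapping.map ((*) c) p"

definition monomial :: "'n list \<Rightarrow> 'n ncpoly" where
  "monomial xs = Poly_Mapping.single (FWord xs) 1"

definition var :: "'n \<Rightarrow> 'n ncpoly" where
  "var i = monomial [i]"

definition nc_extend :: "('n list \<Rightarrow> 'n ncpoly) \<Rightarrow> 'n ncpoly \<Rightarrow> 'n ncpoly" where
  "nc_extend f p = (\<Sum>w\<in>Poly_Mapping.keys p. nc_scale (Poly_Mapping.lookup p w) (f (letters w)))"


section \<open>Derivations, vector fields and cyclic derivatives\<close>

definition derivation :: "('n ncpoly \<Rightarrow> 'n ncpoly) \<Rightarrow> bool" where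
  "derivation D \<longleftrightarrow> Vector_Spaces.linear nc_scale nc_scale D \<and>
     (\<forall>p q. D (p * q) = D p * q + p * D q)"

type_synonym 'n ncvect = "('n ncpoly) ^ 'n"

text \<open>Existence and uniqueness are shown in \<open>ex1_derivation\<close> below.\<close>

definition der :: "'n ncvect \<Rightarrow> 'n::finite ncpoly \<Rightarrow> 'n ncpoly" where
  "der P = (THE D. derivation D \<and> (\<forall>j. D (var j) = P $ j))"

definition vect_scale :: "complex \<Rightarrow> 'n ncvect \<Rightarrow> 'n::finite ncvect" where
  "vect_scale c P = (\<chi> j. nc_scale c (P $ j))"

definition vect_bracket :: "'n ncvect \<Rightarrow> 'n ncvect \<Rightarrow> 'n::finite ncvect" where
  "vect_bracket P Q = (\<chi> j. der P (Q $ j) - der Q (P $ j))"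

definition cyc_deriv :: "'n \<Rightarrow> 'n ncpoly \<Rightarrow> 'n ncpoly" where
  "cyc_deriv j = nc_extend (\<lambda>xs. \<Sum>k | k < length xs \<and> xs ! k = j. monomial (drop (Suc k) xs @ take k xs))"

definition is_trace :: "('n ncpoly \<Rightarrow> complex) \<Rightarrow> bool" where
  "is_trace \<tau> \<longleftrightarrow> Vector_Spaces.linear nc_scale (*) \<tau> \<and> (\<forall>p q. \<tau> (p * q) = \<tau> (q * p))"

definition trace_vect :: "('n ncpoly \<Rightarrow> complex) \<Rightarrow> 'n::finite ncvect set" where
  "trace_vect \<tau> = {P. \<forall>R. (\<Sum>j\<in>UNIV. \<tau> (P $ j * cyc_deriv j R)) = 0}"


section \<open>The vector fields form a Lie algebra\<close>

lemma lookup_nc_scale [simp]: "Poly_Mapping.lookup (nc_scale c p) w = c * Poly_Mapping.lookup p w"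
  unfolding nc_scale_def by transfer (auto simp: when_def)

lemma nc_scale_eq: "nc_scale c p = Poly_Mapping.single 0 c * p"
proof (rule poly_mapping_eqI)
  fix w
  have "Poly_Mapping.lookup (Poly_Mapping.single 0 c * p) w = c * Poly_Mapping.lookup p w"
    by (simp add: times_poly_mapping.rep_eq prod_fun_def lookup_single when_mult Sum_any_when_equal)
  then show "Poly_Mapping.lookup (nc_scale c p) w = Poly_Mapping.lookup (Poly_Mapping.single 0 c * p) w"
    by simp
qed

global_interpretation nc: vector_space nc_scale
  by standard (auto intro!: poly_mapping_eqI simp: lookup_add algebra_simps)

lemma nc_scale_mult_left: "nc_scale c p * q = nc_scale c (p * q)"
  by (simp add: nc_scale_eq mult.assoc)

lemma lookup_sum_keys:
  "(\<Sum>w\<in>Poly_Mapping.keys p. Poly_Mapping.single w (Poly_Mapping.lookup p w)) = p"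
  by (rule poly_mapping_eqI) (auto simp: lookup_sum lookup_single when_def in_keys_iff sum.delta)

lemma nc_scale_single: "nc_scale c (Poly_Mapping.single w d) = Poly_Mapping.single w (c * d)"
  by (rule poly_mapping_eqI) (simp add: lookup_single when_def)

lemma nc_expand: "p = (\<Sum>w\<in>Poly_Mapping.keys p. nc_scale (Poly_Mapping.lookup p w) (monomial (letters w)))"
  by (simp add: monomial_def nc_scale_single lookup_sum_keys)

lemma nc_scale_mult_right: "p * nc_scale c q = nc_scale c (p * q)"
proof -
  have "Poly_Mapping.single w a * nc_scale c q = nc_scale c (Poly_Mapping.single w a * q)" for w a
    unfolding nc_scale_eq by (simp add: mult.assoc[symmetric] mult_single mult.commute)
  then have "(\<Sum>w\<in>Poly_Mapping.keys p. Poly_Mapping.single w (Poly_Mapping.lookup p w)) * nc_scale c q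
      = nc_scale c ((\<Sum>w\<in>Poly_Mapping.keys p. Poly_Mapping.single w (Poly_Mapping.lookup p w)) * q)"
    by (simp add: sum_distrib_right nc.scale_sum_right)
  then show ?thesis
    by (simp add: lookup_sum_keys)
qed

lemma monomial_mult: "monomial xs * monomial ys = monomial (xs @ ys)"
  by (simp add: monomial_def mult_single plus_fword_def)

lemma monomial_Nil: "monomial [] = 1"
  by (simp add: monomial_def zero_fword_def[symmetric])

lemma nc_linear_iff: "Vector_Spaces.linear nc_scale nc_scale f \<longleftrightarrow>
    (\<forall>p q. f (p + q) = f p + f q) \<and> (\<forall>c p. f (nc_scale c p) = nc_scale c (f p))"
  by (simp add: Vector_Spaces.linear_iff nc.vector_space_axioms)

lemma nc_linear_eqI:
  assumes "Vector_Spaces.linear nc_scale nc_scale f" "Vector_Spaces.linear nc_scale nc_scale g"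
    and eq: "\<And>xs. f (monomial xs) = g (monomial xs)"
  shows "f p = g p"
proof -
  interpret f: Vector_Spaces.linear nc_scale nc_scale f by fact
  interpret g: Vector_Spaces.linear nc_scale nc_scale g by fact
  have "f (\<Sum>w\<in>Poly_Mapping.keys p. nc_scale (Poly_Mapping.lookup p w) (monomial (letters w)))
      = g (\<Sum>w\<in>Poly_Mapping.keys p. nc_scale (Poly_Mapping.lookup p w) (monomial (letters w)))"
    by (simp add: f.sum g.sum f.scale g.scale eq)
  then show ?thesis
    by (simp add: nc_expand[symmetric])
qed

lemma nc_extend_superset:
  assumes "finite S" "Poly_Mapping.keys p \<subseteq> S"
  shows "nc_extend f p = (\<Sum>w\<in>S. nc_scale (Poly_Mapping.lookup p w) (f (letters w)))"
  unfolding nc_extend_def using assms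
  by (intro sum.mono_neutral_left) (auto simp: in_keys_iff)

lemma nc_extend_monomial [simp]: "nc_extend f (monomial xs) = f xs"
  by (simp add: nc_extend_def monomial_def)

lemma linear_nc_extend: "Vector_Spaces.linear nc_scale nc_scale (nc_extend f)"
proof -
  have "nc_extend f (p + q) = nc_extend f p + nc_extend f q" for p q
  proof -
    let ?S = "Poly_Mapping.keys p \<union> Poly_Mapping.keys q"
    have "Poly_Mapping.keys (p + q) \<subseteq> ?S" by (rule keys_add)
    then show ?thesis
      by (simp add: nc_extend_superset[of ?S] lookup_add nc.scale_left_distrib sum.distrib)
  qed
  moreover have "nc_extend f (nc_scale c p) = nc_scale c (nc_extend f p)" for c p
  proof -
    have "Poly_Mapping.keys (nc_scale c p) \<subseteq> Poly_Mapping.keys p"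
      by (auto simp: in_keys_iff)
    then show ?thesis
      by (simp add: nc_extend_superset[of "Poly_Mapping.keys p"] nc.scale_sum_right)
  qed
  ultimately show ?thesis
    by (simp add: nc_linear_iff)
qed

lemma derivation_unique:
  assumes D: "derivation D" and E: "derivation E" and gen: "\<And>j. D (var j) = E (var j)"
  shows "D = E"
proof
  fix p
  have one: "F 1 = 0" if "derivation F" for F :: "'a ncpoly \<Rightarrow> 'a ncpoly"
  proof -
    have "F (1 * 1) = F 1 * 1 + 1 * F 1"
      using that unfolding derivation_def by blast
    then show ?thesis by simp
  qed
  have "D (monomial xs) = E (monomial xs)" for xs
  proof (induction xs)
    case Nil
    show ?case using one[OF D] one[OF E] by (simp add: monomial_Nil)
  next
    case (Cons x xs)
    have "monomial (x # xs) = var x * monomial xs"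
      by (simp add: var_def monomial_mult)
    then show ?case
      using D E Cons gen by (simp add: derivation_def)
  qed
  with D E show "D p = E p"
    unfolding derivation_def by (blast intro: nc_linear_eqI)
qed

primrec der_word :: "'n ncvect \<Rightarrow> 'n::finite list \<Rightarrow> 'n ncpoly" where
  "der_word P [] = 0"
| "der_word P (x # xs) = P $ x * monomial xs + var x * der_word P xs"

lemma der_word_append: "der_word P (xs @ ys) = der_word P xs * monomial ys + monomial xs * der_word P ys"
  by (induction xs)
    (simp_all add: monomial_Nil var_def monomial_mult[symmetric] algebra_simps,
     simp add: mult.assoc[symmetric] monomial_mult)

lemma derivation_der_word: "derivation (nc_extend (der_word P))"
proof -
  let ?D = "nc_extend (der_word P)"
  have lin: "?D (p + q) = ?D p + ?D q" "?D (nc_scale c p) = nc_scale c (?D p)" for p q c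
    using linear_nc_extend[of "der_word P"] by (simp_all add: nc_linear_iff)
  have word: "?D (monomial xs * q) = ?D (monomial xs) * q + monomial xs * ?D q" for xs q
    by (rule nc_linear_eqI)
      (simp_all add: nc_linear_iff lin algebra_simps nc_scale_mult_left nc_scale_mult_right
        nc.scale_right_distrib, simp add: monomial_mult der_word_append)
  have "?D (p * q) = ?D p * q + p * ?D q" for p q
    by (rule nc_linear_eqI[where p = p and f = "\<lambda>p. ?D (p * q)" and g = "\<lambda>p. ?D p * q + p * ?D q"])
      (simp_all only: word nc_linear_iff, simp_all add: lin algebra_simps nc_scale_mult_left
        nc_scale_mult_right nc.scale_right_distrib)
  then show ?thesis
    by (simp add: derivation_def linear_nc_extend)
qed

lemma ex1_derivation: "\<exists>!D. derivation D \<and> (\<forall>j. D (var j) = P $ j)"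
proof (rule ex1I)
  show "derivation (nc_extend (der_word P)) \<and> (\<forall>j. nc_extend (der_word P) (var j) = P $ j)"
    by (simp add: derivation_der_word, simp add: var_def monomial_Nil)
  then show "D = nc_extend (der_word P)" if "derivation D \<and> (\<forall>j. D (var j) = P $ j)" for D
    using that by (intro derivation_unique) auto
qed

lemma derivation_der: "derivation (der P)"
  and der_var: "der P (var j) = P $ j"
  using theI'[OF ex1_derivation[of P]] by (simp_all add: der_def)

lemma der_eqI: "derivation D \<Longrightarrow> (\<And>j. D (var j) = P $ j) \<Longrightarrow> der P = D"
  by (rule derivation_unique) (auto simp: derivation_der der_var)

lemma der_simps:
  "der P (p + q) = der P p + der P q"
  "der P (nc_scale c p) = nc_scale c (der P p)"
  "der P (p * q) = der P p * q + p * der P q"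
  using derivation_der[of P] by (simp_all add: derivation_def nc_linear_iff)

lemma der_diff: "der P (p - q) = der P p - der P q"
  using der_simps(1)[of P "p - q" q] by (simp add: algebra_simps)

lemma der_add_field: "der (P + Q) p = der P p + der Q p"
proof -
  have "der (P + Q) = (\<lambda>p. der P p + der Q p)"
    by (rule der_eqI)
      (auto simp: derivation_def nc_linear_iff der_simps der_var algebra_simps nc.scale_right_distrib)
  then show ?thesis by simp
qed

lemma der_scale_field: "der (vect_scale c P) p = nc_scale c (der P p)"
proof -
  have "der (vect_scale c P) = (\<lambda>p. nc_scale c (der P p))"
    by (rule der_eqI)
      (auto simp: derivation_def nc_linear_iff der_simps der_var vect_scale_def
        nc.scale_right_distrib nc_scale_mult_left nc_scale_mult_right mult.commute)
  then show ?thesis by simp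
qed

lemma der_bracket: "der (vect_bracket P Q) p = der P (der Q p) - der Q (der P p)"
proof -
  have "der (vect_bracket P Q) = (\<lambda>p. der P (der Q p) - der Q (der P p))"
    by (rule der_eqI)
      (auto simp: derivation_def nc_linear_iff der_simps der_var vect_bracket_def
        algebra_simps nc.scale_right_diff_distrib)
  then show ?thesis by simp
qed

global_interpretation Vect: lie_algebra vect_scale vect_bracket
proof
  fix a b :: complex and x y z :: "'a ncvect"
  show "vect_scale a (x + y) = vect_scale a x + vect_scale a y"
    by (simp add: vec_eq_iff vect_scale_def nc.scale_right_distrib)
  show "vect_scale (a + b) x = vect_scale a x + vect_scale b x"
    by (simp add: vec_eq_iff vect_scale_def nc.scale_left_distrib)
  show "vect_scale a (vect_scale b x) = vect_scale (a * b) x"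
    by (simp add: vec_eq_iff vect_scale_def)
  show "vect_scale 1 x = x"
    by (simp add: vec_eq_iff vect_scale_def)
  show "vect_bracket (x + y) z = vect_bracket x z + vect_bracket y z"
    by (simp add: vec_eq_iff vect_bracket_def der_add_field der_simps)
  show "vect_bracket x (y + z) = vect_bracket x y + vect_bracket x z"
    by (simp add: vec_eq_iff vect_bracket_def der_add_field der_simps)
  show "vect_bracket (vect_scale a x) y = vect_scale a (vect_bracket x y)"
    by (simp add: vec_eq_iff vect_bracket_def der_scale_field)
      (simp add: vect_scale_def der_simps nc.scale_right_diff_distrib)
  show "vect_bracket x (vect_scale a y) = vect_scale a (vect_bracket x y)"
    by (simp add: vec_eq_iff vect_bracket_def der_scale_field)
      (simp add: vect_scale_def der_simps nc.scale_right_diff_distrib)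
  show "vect_bracket x x = 0"
    by (simp add: vec_eq_iff vect_bracket_def)
  have comp: "vect_bracket u (vect_bracket v w) $ j
      = der u (der v (w $ j)) - der u (der w (v $ j)) - (der v (der w (u $ j)) - der w (der v (u $ j)))"
    for u v w :: "'a ncvect" and j
  proof -
    have "vect_bracket u (vect_bracket v w) $ j
        = der u (vect_bracket v w $ j) - der (vect_bracket v w) (u $ j)"
      by (subst vect_bracket_def) simp
    then show ?thesis
      by (simp only: der_bracket) (simp add: vect_bracket_def der_diff)
  qed
  show "vect_bracket x (vect_bracket y z) + vect_bracket y (vect_bracket z x)
      + vect_bracket z (vect_bracket x y) = 0"
    by (simp add: vec_eq_iff comp)
qed

end

theory Submission
  imports Defs
begin

text \<open>
  Moving the factors to the left of \<open>P\<^sub>j\<close> in each summand of \<open>D\<^sub>P R\<close> cyclically around to the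
  right does not change the trace, so \<open>\<tau> (D\<^sub>P R) = (\<Sum>j. \<tau> (P\<^sub>j (\<delta>\<^sub>j R)))\<close>. The vector fields in question are
  therefore those with \<open>\<tau> \<circ> D\<^sub>P = 0\<close>, a condition stable under commutators of derivations.
\<close>

text \<open>Words span the polynomials; this is the scalar-valued counterpart of
  \<open>nc_linear_eqI\<close>, suited to composites with a trace.\<close>

lemma nc_functional_eqI:
  assumes "Vector_Spaces.linear nc_scale (*) f" "Vector_Spaces.linear nc_scale (*) g"
    and eq: "\<And>xs. f (monomial xs) = g (monomial xs)"
  shows "f p = g p"
proof -
  interpret f: Vector_Spaces.linear nc_scale "(*)" f by fact
  interpret g: Vector_Spaces.linear nc_scale "(*)" g by fact
  show ?thesis
    by (subst (1 2) nc_expand) (simp add: f.sum g.sum f.scale g.scale eq)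
qed

text \<open>Iterated Leibniz rule. Indexing by positions, with \<open>take\<close> and
  \<open>drop\<close>, allows a term-by-term comparison with \<open>cyc_deriv\<close>.\<close>

lemma der_monomial:
  "der P (monomial xs) =
    (\<Sum>k<length xs. monomial (take k xs) * P $ (xs ! k) * monomial (drop (Suc k) xs))"
proof (induction xs)
  case Nil
  \<comment> \<open>This forces \<open>der P 1 = 0\<close>, which is the empty sum.\<close>
  have "der P (1 * 1) = der P 1 * 1 + 1 * der P 1"
    by (rule der_simps)
  then show ?case
    by (simp add: monomial_Nil)
next
  case (Cons x xs)
  have split: "monomial (x # ys) = var x * monomial ys" for ys
    by (simp add: var_def monomial_mult)
  have "der P (monomial (x # xs)) = P $ x * monomial xs + var x * der P (monomial xs)"
    by (simp add: split der_simps der_var)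
  also have "\<dots> = (\<Sum>k<length (x # xs). monomial (take k (x # xs)) * P $ ((x # xs) ! k) *
      monomial (drop (Suc k) (x # xs)))"
    \<comment> \<open>The term at position 0 splits off as \<open>P $ x * monomial xs\<close>; the
      others are those for \<open>xs\<close>, shifted by one and multiplied by \<open>var x\<close>
      on the left.\<close>
    unfolding Cons.IH length_Cons sum.lessThan_Suc_shift
    by (simp add: monomial_Nil split sum_distrib_left mult.assoc)
  finally show ?case .
qed

lemma trace_der:
  fixes P :: "'n::finite ncvect"
  assumes "is_trace \<tau>"
  shows "\<tau> (der P R) = (\<Sum>j\<in>UNIV. \<tau> (P $ j * cyc_deriv j R))"
proof -
  interpret \<tau>: Vector_Spaces.linear nc_scale "(*)" \<tau>
    using assms by (simp add: is_trace_def)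
  have commute: "\<tau> (p * q) = \<tau> (q * p)" for p q
    using assms by (simp add: is_trace_def)
  have cyc: "cyc_deriv j (p + q) = cyc_deriv j p + cyc_deriv j q"
    "cyc_deriv j (nc_scale c p) = nc_scale c (cyc_deriv j p)" for j :: 'n and p q c
    using linear_nc_extend unfolding cyc_deriv_def nc_linear_iff by blast+
  note linear_iff = Vector_Spaces.linear_iff nc.vector_space_axioms \<tau>.vs2.vector_space_axioms
  show ?thesis
  proof (rule nc_functional_eqI[where f = "\<lambda>R. \<tau> (der P R)"])
    show "Vector_Spaces.linear nc_scale (*) (\<lambda>R. \<tau> (der P R))"
      by (simp add: linear_iff der_simps \<tau>.add \<tau>.scale)
    show "Vector_Spaces.linear nc_scale (*) (\<lambda>R. \<Sum>j\<in>UNIV. \<tau> (P $ j * cyc_deriv j R))"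
      by (simp add: linear_iff cyc distrib_left nc_scale_mult_right \<tau>.add \<tau>.scale
          sum.distrib sum_distrib_left)
    fix xs :: "'n list"
    let ?rot = "\<lambda>k. monomial (drop (Suc k) xs @ take k xs)"
    have "\<tau> (der P (monomial xs)) = (\<Sum>k<length xs. \<tau> (P $ (xs ! k) * ?rot k))"
      unfolding der_monomial \<tau>.sum mult.assoc
      by (simp add: commute[of "monomial (take _ xs)"] mult.assoc monomial_mult)
    \<comment> \<open>Positions are grouped by their letter; those carrying the letter j index
      exactly the rotations in \<open>cyc_deriv j (monomial xs)\<close>.\<close>
    also have "\<dots> = (\<Sum>j\<in>UNIV. \<Sum>k | k \<in> {..<length xs} \<and> xs ! k = j. \<tau> (P $ (xs ! k) * ?rot k))"
      by (rule sum.group[symmetric]) auto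
    also have "\<dots> = (\<Sum>j\<in>UNIV. \<tau> (P $ j * cyc_deriv j (monomial xs)))"
      by (simp add: cyc_deriv_def sum_distrib_left \<tau>.sum)
    finally show "\<tau> (der P (monomial xs)) = (\<Sum>j\<in>UNIV. \<tau> (P $ j * cyc_deriv j (monomial xs)))" .
  qed
qed

theorem mainTheorem7:
  fixes \<tau> :: "'n::finite ncpoly \<Rightarrow> complex"
  assumes "is_trace \<tau>"
  shows "Vect.lie_subalgebra (trace_vect \<tau>)"
proof -
  interpret \<tau>: Vector_Spaces.linear nc_scale "(*)" \<tau>
    using assms by (simp add: is_trace_def)
  have mem: "P \<in> trace_vect \<tau> \<longleftrightarrow> (\<forall>R. \<tau> (der P R) = 0)" for P
    by (simp add: trace_vect_def trace_der[OF assms])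
  have "0 \<in> trace_vect \<tau>"
    by (simp add: trace_vect_def \<tau>.zero)
  then show ?thesis
    \<comment> \<open>For the bracket, the condition on P is used at \<open>der Q R\<close> and the
      one on Q at \<open>der P R\<close>, so both terms of the commutator have trace zero.\<close>
    by (auto simp: Vect.lie_subalgebra_def Vect.subspace_def mem der_add_field der_scale_field
        der_bracket \<tau>.add \<tau>.scale \<tau>.diff)
qed

end
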